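(* Let $f:\mathbb{R}^d\to\mathbb{R}$ be $L$-smooth and $\mu$-strongly-convex ($\mu>0$), with minimizer $x^*$. Let $s>0$ and let $m,n,q$ satisfy $$0<m\sqrt s-\frac{ns}{1-q\sqrt s}\le\frac1{2L},\qquad 0<ns\le\frac{1-q\sqrt s}{2}\,m\sqrt s,\qquad 0<q\sqrt s\le\frac12 .$$ Let $(x_k)$ be the position sequence produced by the explicit Euler scheme $$x_{k+1}-x_k=-m\sqrt s\,\nabla f(x_k)-n\sqrt s\,v_k,\qquad v_{k+1}-v_k=\sqrt s\,\nabla f(x_k)-q\sqrt s\,v_k .$$ Then there exists a constant $C>0$ such that for every $k\in\mathbb{N}$ $$f(x_k)-f(x^* )\le(1+\gamma_3\sqrt s)^{-k}\,C,\qquad \gamma_3:=\frac15\min\left(\frac{n\mu}{q(1-q\sqrt s)},\ \frac{q}{1+q^2/(nL)}\right).$$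
   Context: $\|\cdot\|$ is the Euclidean norm. $f$ is $L$-smooth if it is differentiable and $\|\nabla f(x)-\nabla f(y)\|\le L\|x-y\|$ for all $x,y$; $f$ is $\mu$-strongly-convex if $f(y)\ge f(x)+\langle\nabla f(x),y-x\rangle+\frac\mu2\|y-x\|^2$ for all $x,y$. The scheme is started from arbitrary initial data; $C$ is independent of $k$ (it may depend on the initial data and the parameters). *)

theory Defs
  imports "HOL-Analysis.Analysis"
begin

definition grad :: "('a::euclidean_space \<Rightarrow> real) \<Rightarrow> 'a \<Rightarrow> 'a" where
  "grad f x = (THE D. GDERIV f x :> D)"

lemma grad_eqI:
  assumes "GDERIV f x :> D"
  shows "grad f x = D"
  unfolding grad_def
proof (rule the_equality)
  show "GDERIV f x :> D" by (fact assms)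
next
  fix E assume "GDERIV f x :> E"
  then have "(\<lambda>h. inner h E) = (\<lambda>h. inner h D)"
    using assms unfolding gderiv_def by (rule has_derivative_unique)
  then show "E = D"
    by (metis inner_commute vector_eq_rdot)
qed

lemma gderiv_grad:
  assumes "f differentiable (at x)"
  shows "GDERIV f x :> grad f x"
proof -
  from assms obtain f' where f': "(f has_derivative f') (at x)"
    unfolding differentiable_def by blast
  then interpret bounded_linear f' by (rule has_derivative_bounded_linear)
  have "f' h = inner h (\<Sum>b\<in>Basis. f' b *\<^sub>R b)" for h
  proof -
    have "f' h = f' (\<Sum>b\<in>Basis. inner h b *\<^sub>R b)"
      by (simp only: euclidean_representation)
    also have "\<dots> = (\<Sum>b\<in>Basis. inner h b * f' b)"
      by (simp add: sum scaleR)
    also have "\<dots> = inner h (\<Sum>b\<in>Basis. f' b *\<^sub>R b)"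
      by (simp add: inner_sum_right mult.commute)
    finally show ?thesis .
  qed
  then have "GDERIV f x :> (\<Sum>b\<in>Basis. f' b *\<^sub>R b)"
    using f' unfolding gderiv_def by (metis (no_types, lifting) ext)
  then show ?thesis
    using grad_eqI by metis
qed

definition L_smooth :: "real \<Rightarrow> ('a::euclidean_space \<Rightarrow> real) \<Rightarrow> bool" where
  "L_smooth L f \<longleftrightarrow>
     (\<forall>x. f differentiable (at x)) \<and>
     (\<forall>x y. norm (grad f x - grad f y) \<le> L * norm (x - y))"

(* Differentiability is stated explicitly, since grad f x is unspecified where f is
   not differentiable. *)
definition strongly_convex :: "real \<Rightarrow> ('a::euclidean_space \<Rightarrow> real) \<Rightarrow> bool" where
  "strongly_convex \<mu> f \<longleftrightarrow>
     (\<forall>x. f differentiable (at x)) \<and>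
     (\<forall>x y. f y \<ge> f x + inner (grad f x) (y - x) + \<mu> / 2 * (norm (y - x))\<^sup>2)"

definition gamma3 :: "real \<Rightarrow> real \<Rightarrow> real \<Rightarrow> real \<Rightarrow> real \<Rightarrow> real" where
  "gamma3 L \<mu> s n q =
     1 / 5 * min (n * \<mu> / (q * (1 - q * sqrt s))) (q / (1 + q\<^sup>2 / (n * L)))"

end

theory Submission
  imports Defs
begin

text \<open>
  Put \<open>a = q \<surd>s\<close>, \<open>D\<^sub>k = - (n / q) v\<^sub>k\<^sub>+\<^sub>1\<close> and \<open>z\<^sub>k = x\<^sub>k\<^sub>+\<^sub>1 + D\<^sub>k\<close>. In these variables the scheme reads
  \<open>x\<^sub>k\<^sub>+\<^sub>1 = x\<^sub>k + a / (1 - a) D\<^sub>k - \<eta> \<nabla>f(x\<^sub>k)\<close>, \<open>D\<^sub>k\<^sub>+\<^sub>1 = (1 - a) D\<^sub>k - \<kappa> \<nabla>f(x\<^sub>k\<^sub>+\<^sub>1)\<close>, and \<open>z\<close> moves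
  by pure gradient steps, \<open>z\<^sub>k\<^sub>+\<^sub>1 = z\<^sub>k - \<tau> \<nabla>f(x\<^sub>k\<^sub>+\<^sub>1)\<close>. Pairing the position with the \<^emph>\<open>next\<close> velocity
  means that the increment of \<open>f\<close> can be estimated by cocoercivity at \<open>x\<^sub>k\<^sub>+\<^sub>1\<close>, which, unlike the
  descent lemma, produces no positive \<open>\<parallel>D\<parallel>\<^sup>2\<close> term. For the right weight \<open>A\<close> the products
  \<open>\<langle>\<nabla>f(x\<^sub>k\<^sub>+\<^sub>1), D\<^sub>k\<rangle>\<close> cancel, and
  \<open>(1 + \<rho>) A (f(x\<^sub>k) - f(x\<^sup>*)) + \<parallel>z\<^sub>k - x\<^sup>*\<parallel>\<^sup>2 / 2 + \<parallel>D\<^sub>k\<parallel>\<^sup>2 / 2\<close> contracts by \<open>1 / (1 + \<rho>)\<close>, where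
  \<open>\<rho> = \<gamma>\<^sub>3 \<surd>s\<close>.
\<close>

section \<open>Consequences of smoothness and convexity\<close>

text \<open>Along the segment from \<open>x\<close> to \<open>y\<close>, \<open>\<phi>\<close>
  compares \<open>f\<close> with its quadratic upper model at \<open>x\<close>. Cauchy-Schwarz and
  the Lipschitz gradient make its derivative nonpositive.\<close>

lemma L_smooth_descent:
  fixes f :: "'a::euclidean_space \<Rightarrow> real"
  assumes "L_smooth L f"
  shows "f y \<le> f x + grad f x \<bullet> (y - x) + L / 2 * (norm (y - x))\<^sup>2"
proof -
  define \<phi> where "\<phi> t = f (x + t *\<^sub>R (y - x)) - t * (grad f x \<bullet> (y - x))
    - L / 2 * t\<^sup>2 * (norm (y - x))\<^sup>2" for t :: real
  have der: "(\<phi> has_real_derivative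
      ((grad f (x + t *\<^sub>R (y - x)) - grad f x) \<bullet> (y - x) - L * t * (norm (y - x))\<^sup>2)) (at t)" for t
  proof -
    have "f differentiable (at (x + t *\<^sub>R (y - x)))"
      using assms by (simp add: L_smooth_def)
    then have "(f has_derivative (\<lambda>h. h \<bullet> grad f (x + t *\<^sub>R (y - x)))) (at (x + t *\<^sub>R (y - x)))"
      using gderiv_grad unfolding gderiv_def by blast
    moreover have "((\<lambda>t. x + t *\<^sub>R (y - x)) has_derivative (\<lambda>h. h *\<^sub>R (y - x))) (at t)"
      by (auto intro!: derivative_eq_intros)
    ultimately have "((\<lambda>t. f (x + t *\<^sub>R (y - x))) has_derivative
        (\<lambda>h. (h *\<^sub>R (y - x)) \<bullet> grad f (x + t *\<^sub>R (y - x)))) (at t)"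
      by (rule has_derivative_compose[rotated])
    then have "((\<lambda>t. f (x + t *\<^sub>R (y - x))) has_real_derivative
        (y - x) \<bullet> grad f (x + t *\<^sub>R (y - x))) (at t)"
      unfolding has_field_derivative_def
      by (rule has_derivative_eq_rhs) (simp add: fun_eq_iff mult.commute)
    then show ?thesis
      unfolding \<phi>_def
      by (auto intro!: derivative_eq_intros simp: inner_commute inner_diff_left inner_diff_right)
  qed
  have "\<phi> 1 \<le> \<phi> 0"
  proof (rule DERIV_nonpos_imp_nonincreasing[of 0 1])
    fix t :: real
    assume t: "0 \<le> t" "t \<le> 1"
    have "(grad f (x + t *\<^sub>R (y - x)) - grad f x) \<bullet> (y - x)
        \<le> norm (grad f (x + t *\<^sub>R (y - x)) - grad f x) * norm (y - x)"
      by (rule norm_cauchy_schwarz)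
    also have "\<dots> \<le> L * norm (t *\<^sub>R (y - x)) * norm (y - x)"
      using assms unfolding L_smooth_def
      by (intro mult_right_mono) (metis add_diff_cancel_left', simp)
    also have "\<dots> = L * t * (norm (y - x))\<^sup>2"
      using t by (simp add: power2_eq_square)
    finally show "\<exists>d. (\<phi> has_real_derivative d) (at t) \<and> d \<le> 0"
      using der by fastforce
  qed simp
  then show ?thesis by (simp add: \<phi>_def)
qed

text \<open>A gradient step of length \<open>1 / L\<close> lowers \<open>f\<close> by at least the
  squared gradient norm over \<open>2 * L\<close>, which minimality forbids unless the gradient
  vanishes.\<close>

lemma grad_minimizer:
  fixes f :: "'a::euclidean_space \<Rightarrow> real"
  assumes "L_smooth L f" "L > 0" "\<forall>y. f p \<le> f y"
  shows "grad f p = 0"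
proof -
  define u where "u = p - (1 / L) *\<^sub>R grad f p"
  have "f u \<le> f p + grad f p \<bullet> (u - p) + L / 2 * (norm (u - p))\<^sup>2"
    using assms(1) by (rule L_smooth_descent)
  also have "\<dots> = f p - (norm (grad f p))\<^sup>2 / (2 * L)"
    using assms(2) unfolding u_def
    by (simp add: power2_norm_eq_inner power2_eq_square[of L] field_simps)
  finally have "(norm (grad f p))\<^sup>2 / (2 * L) \<le> 0"
    using assms(3) by (smt (verit))
  then show ?thesis
    using assms(2) by (simp add: divide_le_0_iff)
qed

text \<open>Squeeze \<open>f u\<close> between the tangent plane at \<open>x\<close> and the descent
  bound at \<open>y\<close>. The choice of \<open>u\<close> minimizes the gap between these two
  bounds, so the comparison is the sharpest possible.\<close>

lemma convex_L_smooth_cocoercive: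
  fixes f :: "'a::euclidean_space \<Rightarrow> real"
  assumes "L_smooth L f" "L > 0"
    and convex: "\<And>x y. f y \<ge> f x + grad f x \<bullet> (y - x)"
  shows "f y \<ge> f x + grad f x \<bullet> (y - x) + (norm (grad f x - grad f y))\<^sup>2 / (2 * L)"
proof -
  define e where "e = grad f y - grad f x"
  define u where "u = y - (1 / L) *\<^sub>R e"
  have "f x + grad f x \<bullet> (u - x) \<le> f u" by (rule convex)
  also have "f u \<le> f y + grad f y \<bullet> (u - y) + L / 2 * (norm (u - y))\<^sup>2"
    using assms(1) by (rule L_smooth_descent)
  also have "L / 2 * (norm (u - y))\<^sup>2 = (norm e)\<^sup>2 / (2 * L)"
    using assms(2) by (simp add: u_def power2_eq_square field_simps)
  also have "grad f y \<bullet> (u - y) = - (grad f x \<bullet> e + (norm e)\<^sup>2) / L"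
    by (simp add: u_def e_def power2_norm_eq_inner inner_diff_left inner_diff_right
        inner_commute diff_divide_distrib)
  finally have "f x + grad f x \<bullet> (y - x) - grad f x \<bullet> e / L
      \<le> f y - (grad f x \<bullet> e + (norm e)\<^sup>2) / L + (norm e)\<^sup>2 / (2 * L)"
    by (simp add: u_def inner_diff_right diff_divide_distrib add_divide_distrib)
  moreover have "(norm e)\<^sup>2 / L = 2 * ((norm e)\<^sup>2 / (2 * L))" by simp
  ultimately have "f x + grad f x \<bullet> (y - x) + (norm e)\<^sup>2 / (2 * L) \<le> f y"
    unfolding add_divide_distrib by linarith
  then show ?thesis by (simp add: e_def norm_minus_commute)
qed

section \<open>The energy estimate for one step\<close>

text \<open>
  The coefficient condition for \<open>\<parallel>\<nabla>f(x\<^sub>k\<^sub>+\<^sub>1)\<parallel>\<^sup>2\<close>. It is concave in \<open>\<beta>\<close>, and at \<open>\<beta> = \<eta>\<close>, \<open>a = 1/2\<close> it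
  holds with almost no slack, which dictates the weight \<open>3/4 + a/10\<close>.
\<close>
lemma gradient_coefficient_bound:
  fixes a \<beta> \<eta> \<tau> \<kappa> A :: real
  assumes a: "0 < a" "a \<le> 1/2" and \<beta>: "0 < \<beta>" "\<beta> \<le> \<eta>"
    and \<kappa>: "\<kappa> = \<beta> * (1 - a) / a" and \<tau>: "\<tau> = \<eta> + \<beta> / a"
    and A: "A = (1 - a) / a * (\<tau> + (1 - a) * \<kappa>)"
  shows "\<tau>\<^sup>2 + \<kappa>\<^sup>2 \<le> 3/2 * A * \<eta> + 2 * (3/4 + a/10) * \<tau> * \<eta>"
proof -
  \<comment> \<open>After multiplication by \<open>a\<^sup>2\<close>, the right side minus the left
    side is a combination of \<open>\<eta> * (\<eta> - \<beta>)\<close>,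
    \<open>\<eta> * \<beta>\<close> and \<open>\<beta> * (\<eta> - \<beta>)\<close>, all
    nonnegative. \<open>c0\<close>, \<open>c\<close> and \<open>c2\<close> are its
    coefficients.\<close>
  define c0 where "c0 = a * (3/2 - a + a\<^sup>2 / 5)"
  define c where "c = 1 - 3 * a + 27/10 * a\<^sup>2 - 13/10 * a ^ 3"
  define c2 where "c2 = 1 + (1 - a)\<^sup>2"
  have c0: "0 \<le> c0" using a by (simp add: c0_def)
  \<comment> \<open>Taylor expansion at \<open>a = 1/2\<close>: every coefficient is positive, and
    \<open>1/80\<close> is the small slack left at that endpoint.\<close>
  have "c = 1/80 + 51/40 * (1/2 - a) + 3/4 * (1/2 - a)\<^sup>2 + 13/10 * (1/2 - a) ^ 3"
    by (simp add: c_def power2_eq_square power3_eq_cube field_simps)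
  also have "\<dots> \<ge> 0" using a by simp
  finally have c: "0 \<le> c" .
  have c2: "0 \<le> c2" by (simp add: c2_def)
  have "a\<^sup>2 * (3/2 * A * \<eta> + 2 * (3/4 + a/10) * \<tau> * \<eta> - \<tau>\<^sup>2 - \<kappa>\<^sup>2)
      = 3/2 * (1 - a) * (a * \<tau> + (1 - a) * (a * \<kappa>)) * \<eta> + 2 * (3/4 + a/10) * a * (a * \<tau>) * \<eta>
        - (a * \<tau>)\<^sup>2 - (a * \<kappa>)\<^sup>2"
    using a by (simp add: A power2_eq_square field_simps)
  also have "a * \<tau> = a * \<eta> + \<beta>" using a by (simp add: \<tau> field_simps)
  also have "a * \<kappa> = \<beta> * (1 - a)" using a by (simp add: \<kappa>)
  also have "3/2 * (1 - a) * (a * \<eta> + \<beta> + (1 - a) * (\<beta> * (1 - a))) * \<eta>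
        + 2 * (3/4 + a/10) * a * (a * \<eta> + \<beta>) * \<eta> - (a * \<eta> + \<beta>)\<^sup>2 - (\<beta> * (1 - a))\<^sup>2
      = c0 * (\<eta> * (\<eta> - \<beta>)) + c * (\<eta> * \<beta>) + c2 * (\<beta> * (\<eta> - \<beta>))"
    by (simp add: c0_def c_def c2_def power2_eq_square power3_eq_cube field_simps)
  also have "\<dots> \<ge> 0"
    using c0 c c2 \<beta> by (intro add_nonneg_nonneg mult_nonneg_nonneg) auto
  finally show ?thesis
    using a by (simp add: zero_le_mult_iff)
qed

text \<open>Here \<open>g\<close>, \<open>g'\<close> are the gradients at \<open>x\<^sub>k\<close>,
  \<open>x\<^sub>k\<^sub>+\<^sub>1\<close>, \<open>F\<close>, \<open>F'\<close> the gaps to the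
  minimum, \<open>X\<close> is \<open>x\<^sub>k\<^sub>+\<^sub>1 - x\<^sup>*\<close> and
  \<open>D\<close> is \<open>D\<^sub>k\<close>. The extra factor \<open>1 + \<rho>\<close> on the
  gap places the loss at the new point, as \<open>\<rho> * A * F'\<close>, where the term
  \<open>\<tau> * F'\<close> from convexity can pay for it.\<close>

lemma one_step_contraction:
  fixes g g' X D :: "'a::real_inner" and F F' a \<beta> \<eta> \<tau> \<kappa> A \<rho> \<mu> L :: real
  assumes a: "0 < a" "a \<le> 1/2" and \<beta>: "0 < \<beta>" "\<beta> \<le> \<eta>" and \<eta>: "\<eta> \<le> 1 / (2 * L)"
    and \<kappa>: "\<kappa> = \<beta> * (1 - a) / a" and \<tau>: "\<tau> = \<eta> + \<beta> / a"
    and A: "A = (1 - a) / a * (\<tau> + (1 - a) * \<kappa>)"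
    and \<rho>: "0 \<le> \<rho>" "5 * \<rho> \<le> a" "5 * \<rho> \<le> \<beta> * \<mu> / a"
    and F': "0 \<le> F'"
    and step: "F' + g' \<bullet> (\<eta> *\<^sub>R g - (a / (1 - a)) *\<^sub>R D) + (norm (g' - g))\<^sup>2 / (2 * L) \<le> F"
    and strong: "F' + \<mu> / 2 * (norm X)\<^sup>2 \<le> g' \<bullet> X"
    and coco: "F' + (norm g')\<^sup>2 / (2 * L) \<le> g' \<bullet> X"
  shows "(1 + \<rho>) * ((1 + \<rho>) * A * F' + (norm (X + D - \<tau> *\<^sub>R g'))\<^sup>2 / 2
            + (norm ((1 - a) *\<^sub>R D - \<kappa> *\<^sub>R g'))\<^sup>2 / 2)
         \<le> (1 + \<rho>) * A * F + (norm (X + D))\<^sup>2 / 2 + (norm D)\<^sup>2 / 2"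
proof -
  define P where "P = (norm g')\<^sup>2"
  \<comment> \<open>The share of \<open>\<tau> * (g' \<bullet> X)\<close> bounded by cocoercivity;
    strong convexity bounds the rest.\<close>
  define \<theta> where "\<theta> = 3/4 + a/10"
  have P: "0 \<le> P" by (simp add: P_def)
  have pos: "0 < \<eta>" "0 < \<kappa>" "0 < \<tau>" "0 \<le> A"
    using a \<beta> by (auto simp: \<kappa> \<tau> A intro!: divide_pos_pos add_pos_pos mult_pos_pos)
  have \<theta>: "0 \<le> \<theta>" "\<theta> \<le> 1" using a by (simp_all add: \<theta>_def)

  have f_part: "A * F' \<le> A * F + (\<tau> + (1 - a) * \<kappa>) * (g' \<bullet> D) - 3/4 * A * \<eta> * P"
  proof -
    have "\<eta> * (norm (g' - g))\<^sup>2 \<le> (norm (g' - g))\<^sup>2 / (2 * L)"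
      using mult_right_mono[OF \<eta>, of "(norm (g' - g))\<^sup>2"] by simp
    \<comment> \<open>Completing the square eliminates \<open>g\<close> and is the source of the
      factor \<open>3/4\<close>.\<close>
    moreover have "0 \<le> \<eta> * (norm ((g' - g) - (1/2) *\<^sub>R g'))\<^sup>2" using pos by simp
    then have "3/4 * \<eta> * P \<le> \<eta> * (g' \<bullet> g) + \<eta> * (norm (g' - g))\<^sup>2"
      by (simp add: P_def power2_norm_eq_inner inner_diff_left inner_diff_right inner_commute
          algebra_simps)
    ultimately have "F' \<le> F + a / (1 - a) * (g' \<bullet> D) - 3/4 * \<eta> * P"
      using step by (simp add: inner_diff_right)
    from mult_left_mono[OF this, of A] have "A * F'
        \<le> A * F + (A * (a / (1 - a))) * (g' \<bullet> D) - 3/4 * A * \<eta> * P"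
      using pos by (simp add: algebra_simps)
    \<comment> \<open>This is what fixes \<open>A\<close>: the coefficient of
      \<open>g' \<bullet> D\<close> becomes exactly what \<open>z_part\<close> and
      \<open>D_part\<close> subtract.\<close>
    moreover have "A * (a / (1 - a)) = \<tau> + (1 - a) * \<kappa>"
      using a by (simp add: A)
    ultimately show ?thesis by (simp only:)
  qed

  have z_part: "(norm (X + D - \<tau> *\<^sub>R g'))\<^sup>2 / 2
      = (norm (X + D))\<^sup>2 / 2 - \<tau> * (g' \<bullet> X) - \<tau> * (g' \<bullet> D) + \<tau>\<^sup>2 / 2 * P"
    by (simp add: P_def power2_norm_eq_inner inner_diff_left inner_diff_right inner_add_left
        inner_add_right inner_commute power2_eq_square[of \<tau>] field_simps)

  have D_part: "(norm ((1 - a) *\<^sub>R D - \<kappa> *\<^sub>R g'))\<^sup>2 / 2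
      = (norm D)\<^sup>2 / 2 - a * (2 - a) / 2 * (norm D)\<^sup>2 - (1 - a) * \<kappa> * (g' \<bullet> D) + \<kappa>\<^sup>2 / 2 * P"
    by (simp add: P_def power2_norm_eq_inner inner_diff_left inner_diff_right
        inner_add_left inner_add_right inner_commute power2_eq_square[of \<kappa>] field_simps)

  have X_part: "\<tau> * F' + (1 - \<theta>) * \<tau> * \<mu> / 2 * (norm X)\<^sup>2 + \<theta> * \<tau> * \<eta> * P \<le> \<tau> * (g' \<bullet> X)"
  proof -
    have "\<eta> * P \<le> P / (2 * L)"
      using mult_right_mono[OF \<eta> P] by simp
    then have "F' + \<eta> * P \<le> g' \<bullet> X" using coco by (simp add: P_def)
    from mult_left_mono[OF this \<theta>(1)] mult_left_mono[OF strong, of "1 - \<theta>"] \<theta>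
    have "F' + (1 - \<theta>) * \<mu> / 2 * (norm X)\<^sup>2 + \<theta> * \<eta> * P \<le> g' \<bullet> X"
      by (simp add: algebra_simps)
    from mult_left_mono[OF this, of \<tau>] pos show ?thesis
      by (simp add: algebra_simps)
  qed

  have P_coeff: "\<tau>\<^sup>2 / 2 * P + \<kappa>\<^sup>2 / 2 * P \<le> 3/4 * A * \<eta> * P + \<theta> * \<tau> * \<eta> * P"
    using mult_right_mono[OF gradient_coefficient_bound[OF a \<beta> \<kappa> \<tau> A] P]
    by (simp add: \<theta>_def algebra_simps)

  have F_coeff: "\<rho> * A * F' \<le> \<tau> * F'"
  proof -
    \<comment> \<open>This yields \<open>a * A \<le> 2 * \<tau>\<close>, hence
      \<open>\<rho> * A \<le> 2/5 * \<tau>\<close>.\<close>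
    have "\<kappa> \<le> \<tau>" using a \<beta> by (simp add: \<kappa> \<tau> field_simps)
    then have "(1 - a) * \<kappa> \<le> 1 * \<tau>" using a pos by (intro mult_mono) auto
    then have "(1 - a) * (\<tau> + (1 - a) * \<kappa>) \<le> 1 * (2 * \<tau>)"
      using a pos by (intro mult_mono) auto
    then have "a * A \<le> 2 * \<tau>" using a by (simp add: A)
    moreover have "5 * \<rho> * A \<le> a * A" using \<rho> pos by (intro mult_right_mono) auto
    ultimately have "\<rho> * A \<le> \<tau>" using pos by linarith
    then show ?thesis using F' by (rule mult_right_mono)
  qed

  have XD_coeff: "\<rho> * ((norm (X + D))\<^sup>2 / 2 + (norm D)\<^sup>2 / 2)
      \<le> (1 - \<theta>) * \<tau> * \<mu> / 2 * (norm X)\<^sup>2 + a * (2 - a) / 2 * (norm D)\<^sup>2"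
  proof -
    \<comment> \<open>Young's inequality, weighted so that \<open>X\<close> costs only
      \<open>5/4 * \<rho>\<close>, matching the share \<open>1 - \<theta>\<close>, which can be
      below \<open>1/4\<close>. The cost \<open>6 * \<rho>\<close> for \<open>D\<close> fits under
      \<open>a * (2 - a)\<close>.\<close>
    have "0 \<le> (norm ((1/2) *\<^sub>R X - 2 *\<^sub>R D))\<^sup>2" by simp
    then have "(norm (X + D))\<^sup>2 \<le> 5/4 * (norm X)\<^sup>2 + 5 * (norm D)\<^sup>2"
      by (simp add: power2_norm_eq_inner inner_diff_left inner_diff_right inner_add_left
        inner_add_right inner_commute algebra_simps)
    from mult_left_mono[OF this \<rho>(1)]
    have 1: "\<rho> * (norm (X + D))\<^sup>2 \<le> 5/4 * \<rho> * (norm X)\<^sup>2 + 5 * \<rho> * (norm D)\<^sup>2"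
      by (simp add: algebra_simps)
    have \<mu>: "0 \<le> \<mu>"
    proof -
      have "0 \<le> \<beta> * \<mu> / a" using \<rho> by linarith
      then show ?thesis using a \<beta> by (simp add: zero_le_divide_iff zero_le_mult_iff)
    qed
    \<comment> \<open>Since \<open>\<beta> \<le> \<eta>\<close>, \<open>\<tau>\<close> exceeds
      \<open>\<beta> / a\<close> by a factor \<open>1 + a\<close>, which makes up for
      \<open>1 - \<theta>\<close> falling below \<open>1/4\<close>.\<close>
    have "\<beta> / a * (1 + a) \<le> \<tau>" using a \<beta> by (simp add: \<tau> field_simps)
    from mult_right_mono[OF this \<mu>] have "(1 + a) * (\<beta> * \<mu> / a) \<le> \<tau> * \<mu>"
      by (simp add: mult_ac)
    moreover have "(1 + a) * (5 * \<rho>) \<le> (1 + a) * (\<beta> * \<mu> / a)"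
      using \<rho> a by (intro mult_left_mono) auto
    ultimately have "(1 + a) * (5 * \<rho>) \<le> \<tau> * \<mu>" by linarith
    then have "(1 - \<theta>) * ((1 + a) * (5 * \<rho>)) \<le> (1 - \<theta>) * (\<tau> * \<mu>)"
      using \<theta> by (intro mult_left_mono) auto
    moreover have "5/4 * \<rho> \<le> (1 - \<theta>) * ((1 + a) * (5 * \<rho>))"
    proof -
      have "a * a \<le> 1/2 * a" using a by (intro mult_right_mono) auto
      then have "1/4 \<le> (1 - \<theta>) * (1 + a)" using a by (simp add: \<theta>_def algebra_simps)
      from mult_right_mono[OF this, of "5 * \<rho>"] \<rho> show ?thesis by (simp add: mult_ac)
    qed
    ultimately have "5/4 * \<rho> \<le> (1 - \<theta>) * \<tau> * \<mu>"
      unfolding mult.assoc by (rule order_trans[rotated])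
    then have 2: "5/4 * \<rho> * (norm X)\<^sup>2 \<le> (1 - \<theta>) * \<tau> * \<mu> * (norm X)\<^sup>2"
      by (rule mult_right_mono) simp
    have "3/2 * (5 * \<rho>) \<le> (2 - a) * a"
      using a \<rho> by (intro mult_mono) auto
    then have "6 * \<rho> \<le> a * (2 - a)" using \<rho> by (simp add: mult.commute)
    then have 3: "6 * \<rho> * (norm D)\<^sup>2 \<le> a * (2 - a) * (norm D)\<^sup>2"
      by (rule mult_right_mono) simp
    from 1 2 3 show ?thesis by (simp add: field_simps)
  qed

  define R where "R = (norm (X + D))\<^sup>2 / 2 + (norm D)\<^sup>2 / 2"
  define R' where "R' = (norm (X + D - \<tau> *\<^sub>R g'))\<^sup>2 / 2 + (norm ((1 - a) *\<^sub>R D - \<kappa> *\<^sub>R g'))\<^sup>2 / 2"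
  \<comment> \<open>Summing the estimates cancels \<open>g' \<bullet> D\<close>. It remains to use
    \<open>(1 + \<rho>) * (1 - \<rho>) \<le> 1\<close>.\<close>
  have "A * F' + R' \<le> A * F + R - \<rho> * A * F' - \<rho> * R"
    using f_part X_part P_coeff F_coeff XD_coeff
    unfolding R'_def R_def z_part D_part by (simp add: algebra_simps)
  then have "(1 + \<rho>) * A * F' + R' \<le> A * F + (1 - \<rho>) * R"
    by (simp add: algebra_simps)
  then have "(1 + \<rho>) * ((1 + \<rho>) * A * F' + R') \<le> (1 + \<rho>) * (A * F + (1 - \<rho>) * R)"
    using \<rho> by (intro mult_left_mono) auto
  also have "\<dots> = (1 + \<rho>) * A * F + R - \<rho>\<^sup>2 * R"
    by (simp add: algebra_simps power2_eq_square)
  also have "\<dots> \<le> (1 + \<rho>) * A * F + R"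
    by (simp add: R_def)
  finally show ?thesis by (simp add: R_def R'_def algebra_simps)
qed

section \<open>Application to the scheme\<close>

theorem corollary6:
  fixes f :: "real ^ 'd \<Rightarrow> real"
    and xstar :: "real ^ 'd"
    and x v :: "nat \<Rightarrow> real ^ 'd"
    and L \<mu> s m n q :: real
  assumes smooth: "L_smooth L f"
    and convex: "strongly_convex \<mu> f"
    and mu_pos: "\<mu> > 0"
    and minimizer: "\<forall>y. f xstar \<le> f y"
    and s_pos: "s > 0"
    and m_lower: "0 < m * sqrt s - n * s / (1 - q * sqrt s)"
    and m_upper: "m * sqrt s - n * s / (1 - q * sqrt s) \<le> 1 / (2 * L)"
    and n_lower: "0 < n * s"
    and n_upper: "n * s \<le> (1 - q * sqrt s) / 2 * (m * sqrt s)"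
    and q_lower: "0 < q * sqrt s"
    and q_upper: "q * sqrt s \<le> 1 / 2"
    and x_step: "\<forall>k. x (Suc k) - x k =
          - (m * sqrt s) *\<^sub>R grad f (x k) - (n * sqrt s) *\<^sub>R v k"
    and v_step: "\<forall>k. v (Suc k) - v k =
          sqrt s *\<^sub>R grad f (x k) - (q * sqrt s) *\<^sub>R v k"
  shows "\<exists>C>0. \<forall>k::nat.
           f (x k) - f xstar \<le> (1 + gamma3 L \<mu> s n q * sqrt s) powi (- int k) * C"
proof -
  define h where "h = sqrt s"
  define a where "a = q * h"
  define \<beta> where "\<beta> = n * s / (1 - a)"
  define \<eta> where "\<eta> = m * h - \<beta>"
  define \<kappa> where "\<kappa> = \<beta> * (1 - a) / a"
  define \<tau> where "\<tau> = \<eta> + \<beta> / a"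
  define A where "A = (1 - a) / a * (\<tau> + (1 - a) * \<kappa>)"
  define \<rho> where "\<rho> = gamma3 L \<mu> s n q * h"
  have h: "0 < h" "s = h * h" using s_pos by (simp_all add: h_def)
  have a: "0 < a" "a \<le> 1/2" using q_lower q_upper by (simp_all add: a_def h_def)
  have n: "0 < n" using n_lower s_pos by (simp add: zero_less_mult_iff)
  have q: "0 < q" using a(1) h by (simp add: a_def zero_less_mult_iff)
  have \<eta>: "0 < \<eta>" "\<eta> \<le> 1 / (2 * L)"
    using m_lower m_upper by (simp_all add: \<eta>_def \<beta>_def a_def h_def)
  \<comment> \<open>A positive lower bound for \<open>1 / (2 * L)\<close> excludes
    \<open>L = 0\<close> as well, because division by zero gives \<open>0\<close>.\<close>
  then have L: "0 < L" by (smt (verit) zero_less_divide_iff)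
  \<comment> \<open>The upper bound on \<open>n * s\<close> is precisely the condition
    \<open>\<beta> \<le> \<eta>\<close>.\<close>
  have "n * s \<le> m * h / 2 * (1 - a)" using n_upper by (simp add: a_def h_def mult_ac)
  then have "\<beta> \<le> m * h / 2"
    unfolding \<beta>_def using a by (subst pos_divide_le_eq) auto
  moreover have "0 < \<beta>" using n_lower a by (simp add: \<beta>_def)
  ultimately have \<beta>: "0 < \<beta>" "\<beta> \<le> \<eta>" by (simp_all add: \<eta>_def)
  have A: "0 < A"
    using a \<beta> by (auto simp: A_def \<kappa>_def \<tau>_def intro!: divide_pos_pos add_pos_pos mult_pos_pos)

  \<comment> \<open>Each argument of the minimum in \<open>gamma3\<close> supplies one bound:
    \<open>r1 * h\<close> equals \<open>\<beta> * \<mu> / a\<close>, and \<open>r2 \<le> q\<close>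
    gives \<open>a\<close>.\<close>
  have \<rho>: "0 < \<rho>" "5 * \<rho> \<le> a" "5 * \<rho> \<le> \<beta> * \<mu> / a"
  proof -
    define r1 where "r1 = n * \<mu> / (q * (1 - a))"
    define r2 where "r2 = q / (1 + q\<^sup>2 / (n * L))"
    have \<rho>_eq: "5 * \<rho> = min r1 r2 * h"
      by (simp add: \<rho>_def gamma3_def r1_def r2_def a_def h_def)
    have den: "1 \<le> 1 + q\<^sup>2 / (n * L)" using n L by simp
    have "0 < r1" using n mu_pos q a by (simp add: r1_def)
    moreover have "0 < r2" using q den by (simp add: r2_def)
    ultimately have "0 < 5 * \<rho>" using h by (simp add: \<rho>_eq)
    then show "0 < \<rho>" by simp
    have "r2 \<le> q" using q den by (simp add: r2_def divide_le_eq)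
    then show "5 * \<rho> \<le> a" using h unfolding \<rho>_eq a_def by (intro mult_right_mono) auto
    have "\<beta> * \<mu> / a = r1 * h"
      using h q a by (simp add: \<beta>_def r1_def field_simps a_def)
    then show "5 * \<rho> \<le> \<beta> * \<mu> / a" using h unfolding \<rho>_eq by (simp add: mult_right_mono)
  qed

  have strong: "f y \<ge> f u + grad f u \<bullet> (y - u) + \<mu> / 2 * (norm (y - u))\<^sup>2" for u y
    using convex by (simp add: strongly_convex_def)
  have "f y \<ge> f u + grad f u \<bullet> (y - u)" for u y
    using strong[of u y] mu_pos by (smt (verit) divide_nonneg_nonneg mult_nonneg_nonneg zero_le_power2)
  note coco = convex_L_smooth_cocoercive[OF smooth L this]
  have grad0: "grad f xstar = 0"
    using smooth L minimizer by (rule grad_minimizer)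

  define D where "D k = - (n / q) *\<^sub>R v (Suc k)" for k
  define E where "E k = (1 + \<rho>) * A * (f (x k) - f xstar)
      + (norm (x (Suc k) - xstar + D k))\<^sup>2 / 2 + (norm (D k))\<^sup>2 / 2" for k
  have \<kappa>_eq: "\<kappa> = n / q * h"
    using a h q by (simp add: \<kappa>_def \<beta>_def a_def field_simps)
  have \<tau>_eq: "\<tau> = m * h + \<kappa>"
    using a by (simp add: \<tau>_def \<kappa>_def \<eta>_def field_simps)
  have v_Suc: "v (Suc k) = (1 - a) *\<^sub>R v k + h *\<^sub>R grad f (x k)" for k
    using v_step[rule_format, of k] by (simp add: a_def h_def algebra_simps)
  have aD: "a *\<^sub>R D k = - (n * h) *\<^sub>R v (Suc k)" for k
    using q by (simp add: D_def a_def)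
  \<comment> \<open>Expressing \<open>v k\<close> through \<open>v (Suc k)\<close> shortens the
    gradient step from \<open>m * h\<close> to \<open>\<eta>\<close>.\<close>
  have x_Suc: "x (Suc k) - x k = (a / (1 - a)) *\<^sub>R D k - \<eta> *\<^sub>R grad f (x k)" for k
  proof -
    have "(a / (1 - a)) *\<^sub>R D k = (1 / (1 - a)) *\<^sub>R (a *\<^sub>R D k)" by simp
    also have "\<dots> = - (n * h) *\<^sub>R v k - (n * h * h / (1 - a)) *\<^sub>R grad f (x k)"
      using a by (simp add: aD v_Suc scaleR_right_distrib scaleR_right_diff_distrib)
    finally show ?thesis
      using x_step[rule_format, of k] h(1) by (simp add: \<eta>_def \<beta>_def h(2) algebra_simps)
  qed
  have D_Suc: "D (Suc k) = (1 - a) *\<^sub>R D k - \<kappa> *\<^sub>R grad f (x (Suc k))" for k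
    unfolding D_def v_Suc[of "Suc k"] \<kappa>_eq by (simp add: scaleR_right_distrib mult_ac)
  \<comment> \<open>The drift \<open>a *\<^sub>R D k\<close> of the position compensates the damping
    of \<open>D k\<close>, so only gradient terms change \<open>z\<close>.\<close>
  have z_Suc: "x (Suc (Suc k)) - xstar + D (Suc k)
      = x (Suc k) - xstar + D k - \<tau> *\<^sub>R grad f (x (Suc k))" for k
  proof -
    have "x (Suc (Suc k)) = x (Suc k) - (m * h) *\<^sub>R grad f (x (Suc k)) + a *\<^sub>R D k"
      using x_step[rule_format, of "Suc k"] by (simp add: aD h_def algebra_simps)
    then show ?thesis
      by (simp add: D_Suc \<tau>_eq algebra_simps)
  qed

  have E_step: "(1 + \<rho>) * E (Suc k) \<le> E k" for k
    unfolding E_def z_Suc unfolding D_Suc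
  proof (rule one_step_contraction[OF a \<beta> \<eta>(2) \<kappa>_def \<tau>_def A_def _ \<rho>(2,3)])
    show "0 \<le> \<rho>" using \<rho> by simp
    show "0 \<le> f (x (Suc k)) - f xstar" using minimizer by simp
    have "x k - x (Suc k) = \<eta> *\<^sub>R grad f (x k) - (a / (1 - a)) *\<^sub>R D k"
      using x_Suc[of k] by (simp add: algebra_simps)
    with coco[of "x (Suc k)" "x k"]
    show "f (x (Suc k)) - f xstar
        + grad f (x (Suc k)) \<bullet> (\<eta> *\<^sub>R grad f (x k) - (a / (1 - a)) *\<^sub>R D k)
        + (norm (grad f (x (Suc k)) - grad f (x k)))\<^sup>2 / (2 * L) \<le> f (x k) - f xstar"
      by simp
    show "f (x (Suc k)) - f xstar + \<mu> / 2 * (norm (x (Suc k) - xstar))\<^sup>2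
        \<le> grad f (x (Suc k)) \<bullet> (x (Suc k) - xstar)"
      using strong[of "x (Suc k)" xstar] by (simp add: norm_minus_commute inner_diff_right)
    show "f (x (Suc k)) - f xstar + (norm (grad f (x (Suc k))))\<^sup>2 / (2 * L)
        \<le> grad f (x (Suc k)) \<bullet> (x (Suc k) - xstar)"
      using coco[of "x (Suc k)" xstar] by (simp add: grad0 inner_diff_right)
  qed
  have E_decay: "(1 + \<rho>) ^ k * E k \<le> E 0" for k
  proof (induction k)
    case (Suc k)
    have "(1 + \<rho>) ^ k * ((1 + \<rho>) * E (Suc k)) \<le> (1 + \<rho>) ^ k * E k"
      using E_step \<rho> by (intro mult_left_mono) auto
    with Suc show ?case by (simp add: mult_ac)
  qed simp

  have gap: "0 \<le> f (x k) - f xstar" for k using minimizer by simp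
  have E_nonneg: "0 \<le> E k" for k
    unfolding E_def using gap \<rho> A by (intro add_nonneg_nonneg mult_nonneg_nonneg) auto
  \<comment> \<open>The summand \<open>1\<close> keeps the constant positive even when
    \<open>E 0 = 0\<close>, as for a start at rest in the minimizer.\<close>
  have "f (x k) - f xstar \<le> (1 + \<rho>) powi (- int k) * (E 0 / A + 1)" for k
  proof -
    have "A * (f (x k) - f xstar) \<le> (1 + \<rho>) * (A * (f (x k) - f xstar))"
      using \<rho> mult_nonneg_nonneg[OF less_imp_le[OF A] gap[of k]]
      by (simp add: mult_le_cancel_right1 not_less)
    also have "\<dots> \<le> E k" by (simp add: E_def mult.assoc)
    finally have "(1 + \<rho>) ^ k * (A * (f (x k) - f xstar)) \<le> (1 + \<rho>) ^ k * E k"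
      using \<rho> by (intro mult_left_mono) auto
    also have "\<dots> \<le> E 0" by (rule E_decay)
    also have "\<dots> \<le> A * (E 0 / A + 1)" using A by (simp add: field_simps)
    finally have "A * ((1 + \<rho>) ^ k * (f (x k) - f xstar)) \<le> A * (E 0 / A + 1)"
      by (simp add: mult_ac)
    then have "(1 + \<rho>) ^ k * (f (x k) - f xstar) \<le> E 0 / A + 1"
      using A by (simp only: mult_le_cancel_left_pos)
    then show ?thesis
      using \<rho> by (simp add: power_int_minus field_simps)
  qed
  moreover have "0 < E 0 / A + 1" using E_nonneg[of 0] A by (simp add: add_nonneg_pos)
  ultimately show ?thesis unfolding \<rho>_def h_def by blast
qed

end
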